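(* Let $\Gamma$ be a group of polynomial growth of degree $d$. Let $C \geq 1$ be a constant such that $$\frac{1}{C} m^d \leq \gamma(m) \leq C m^d \quad \text{for all } m \in \mathbb{N},$$ and let $c := 3^d C^2$. Let $R, n, r > 2$ be natural numbers and let $X \subseteq \mathrm{B}(R)$ be a subset of the ball $\mathrm{B}(R) \subset \Gamma$. Suppose that to each $p \in X$ there are associated balls $A_1(p), \dots, A_n(p)$ in $\Gamma$ such that: (i) $p \in A_i(p) \subseteq \mathrm{B}(R)$ for $i = 1, \dots, n$; (ii) for all $i = 1, \dots, n-1$ the $r$-enlargement of $A_i(p)$ is contained in $A_{i+1}(p)$. Let $S_i := \bigcup_{p \in X} A_i(p)$ for $i = 1, \dots, n$. Then there is a disjoint subcollection $\mathcal{C}$ of $\{A_i(p)\}_{p \in X,\, i = 1, \dots, n}$ such that the following hold: (a) The union of the $\left(1 + \frac{4}{r-2}\right)$-enlargements of the balls in $\mathcal{C}$ together with the set $S_n \setminus S_1$ covers all but at most a $\left(\frac{c-1}{c}\right)^n$-fraction of $S_n$, that is, $$\left| S_n \setminus \left( (S_n \setminus S_1) \cup \bigcup_{W \in \mathcal{C}} \left(1 + \tfrac{4}{r-2}\right) \cdot W \right) \right| \leq \left(\frac{c-1}{c}\right)^n |S_n|;$$ (b) The measure (cardinality) of the union of the $\left(1 + \frac{4}{r-2}\right)$-enlargements of the balls in $\mathcal{C}$ is at least $\left(1 - \left(\frac{c-1}{c}\right)^n\right)$ times the measure of $S_1$, that is, $$\left| \bigcup_{W \in \mathcal{C}} \left(1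 + \tfrac{4}{r-2}\right) \cdot W \right| \geq \left(1 - \left(\frac{c-1}{c}\right)^n\right) |S_1|.$$
   Context: Let $\Gamma$ be a finitely generated group with a fixed finite generating set $\{\gamma_1,\dots,\gamma_k\}$. The norm of $\gamma\in\Gamma$ is $\|\gamma\| := \inf\{\sum_{i=1}^l |p_i| : \gamma = \gamma_{i_1}^{p_1}\cdots\gamma_{i_l}^{p_l},\ p_i \in \mathbb{Z}\}$, i.e. the word length. $\Gamma$ is viewed as a metric space with the right-invariant word metric $d(x,y) = \|xy^{-1}\|$. For $x \in \Gamma$ and real $t \geq 0$, $\mathrm{B}(x,t) := \{y \in \Gamma : d(x,y) \leq t\}$ is the closed ball, and $\mathrm{B}(t) := \mathrm{B}(\mathrm{e},t) = \{\gamma : \|\gamma\|\le t\}$, where $\mathrm{e}$ is the neutral element. The growth function is $\gamma(n) := |\mathrm{B}(n)|$, where $|\cdot|$ denotes cardinality. $\mathbb{N}=\{1,2,\dots\}$. $\Gamma$ is of polynomial growth if there are constants $C', d' > 0$ with $\gamma(n) \leq C'(n^{d'}+1)$ for all $n \geq 1$. It is known that then there is a unique integer $d \geq 0$, the degree of polynomial growth, for which some $C>0$ satisfies $\frac{1}{C} n^d \leq \gamma(n) \leq C n^d$ for all $n \in \mathbb{N}$. Balls are understood as given with a specified center and radius. For a ball $B = \mathrm{B}(x,\rho)$ and a real $t \geq 0$, the $t$-enlargement of $B$ is $t \cdot B := \mathrm{B}(x, t\rho)$. The balls $A_i(p)$ are not required to be centered at $p$. A collection of balls is disjoint if its members are pairwise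 disjoint. *)

theory Defs
  imports Complex_Main "HOL-Algebra.Generated_Groups" "HOL-Library.Disjoint_Sets"
begin

text \<open>
  A word \<open>[(g\<^sub>1, p\<^sub>1), \<dots>, (g\<^sub>l, p\<^sub>l)]\<close> stands for the product \<open>g\<^sub>1\<^bsup>p\<^sub>1\<^esup> \<cdots> g\<^sub>l\<^bsup>p\<^sub>l\<^esup>\<close>
  with integer exponents; the empty word stands for the neutral element.
\<close>

definition word_val :: "('a, 'm) monoid_scheme \<Rightarrow> ('a \<times> int) list \<Rightarrow> 'a" where
  "word_val G w = foldr (\<lambda>(g, p) y. (g [^]\<^bsub>G\<^esub> p) \<otimes>\<^bsub>G\<^esub> y) w \<one>\<^bsub>G\<^esub>"

definition word_weight :: "('a \<times> int) list \<Rightarrow> nat" where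
  "word_weight w = (\<Sum>(g, p)\<leftarrow>w. nat \<bar>p\<bar>)"

text \<open>
  Every element of a generated group has a word, so that on the carrier the infimum below is
  taken over a nonempty set of natural numbers.
\<close>

definition word_norm :: "('a, 'm) monoid_scheme \<Rightarrow> 'a set \<Rightarrow> 'a \<Rightarrow> nat" where
  "word_norm G gens x = (INF w \<in> {w. fst ` set w \<subseteq> gens \<and> word_val G w = x}. word_weight w)"

definition word_dist :: "('a, 'm) monoid_scheme \<Rightarrow> 'a set \<Rightarrow> 'a \<Rightarrow> 'a \<Rightarrow> nat" where
  "word_dist G gens x y = word_norm G gens (x \<otimes>\<^bsub>G\<^esub> inv\<^bsub>G\<^esub> y)"

definition word_ball :: "('a, 'm) monoid_scheme \<Rightarrow> 'a set \<Rightarrow> 'a \<Rightarrow> real \<Rightarrow> 'a set" where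
  "word_ball G gens x t = {y \<in> carrier G. real (word_dist G gens x y) \<le> t}"

definition growth :: "('a, 'm) monoid_scheme \<Rightarrow> 'a set \<Rightarrow> nat \<Rightarrow> nat" where
  "growth G gens m = card (word_ball G gens \<one>\<^bsub>G\<^esub> (real m))"

definition polynomial_growth :: "('a, 'm) monoid_scheme \<Rightarrow> 'a set \<Rightarrow> bool" where
  "polynomial_growth G gens \<longleftrightarrow>
     (\<exists>C' > 0. \<exists>d' > 0. \<forall>m \<ge> 1. real (growth G gens m) \<le> C' * (real m powr d' + 1))"

definition growth_bounds :: "('a, 'm) monoid_scheme \<Rightarrow> 'a set \<Rightarrow> nat \<Rightarrow> real \<Rightarrow> bool" where
  "growth_bounds G gens d C \<longleftrightarrow>
     (\<forall>m \<ge> 1. 1 / C * real m ^ d \<le> real (growth G gens m) \<and>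
              real (growth G gens m) \<le> C * real m ^ d)"

definition polynomial_growth_of_degree ::
    "('a, 'm) monoid_scheme \<Rightarrow> 'a set \<Rightarrow> nat \<Rightarrow> bool" where
  "polynomial_growth_of_degree G gens d \<longleftrightarrow>
     polynomial_growth G gens \<and> (\<exists>C > 0. growth_bounds G gens d C)"

text \<open>
  Since the enlargement of a ball depends on its center and radius, which the underlying set need
  not determine, a ball is represented by the pair of its center and its radius.
\<close>

type_synonym 'a wball = "'a \<times> real"

definition is_wball :: "('a, 'm) monoid_scheme \<Rightarrow> 'a wball \<Rightarrow> bool" where
  "is_wball G B \<longleftrightarrow> fst B \<in> carrier G \<and> snd B \<ge> 0"

definition points :: "('a, 'm) monoid_scheme \<Rightarrow> 'a set \<Rightarrow> 'a wball \<Rightarrow> 'a set" where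
  "points G gens B = word_ball G gens (fst B) (snd B)"

definition enlarge :: "real \<Rightarrow> 'a wball \<Rightarrow> 'a wball" where
  "enlarge t B = (fst B, t * snd B)"

end

theory Submission
  imports Defs
begin

text \<open>
  The collection is built from the top level downwards. Among the level-\<open>n\<close> balls that are maximal
  for inclusion a Vitali argument picks a disjoint family whose threefold enlargements cover
  \<open>S\<^sub>n\<close>; since tripling a radius multiplies the size of a ball by at most \<open>c\<close>, the picked balls fill a
  \<open>1/c\<close>-fraction of \<open>S\<^sub>n\<close>. All points \<open>p\<close> whose ball one level below meets a picked ball are then
  discarded, and the construction continues with the next level and the remaining points. As the balls
  of a point are nested, what the remaining points span at the next level lies in the part of the
  previous level that has not been filled. Hence the unfilled part shrinks by the factor \<open>(c - 1)/c\<close> at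
  each of the \<open>n\<close> levels, and balls picked at different levels are disjoint.

  It remains to see that a discarded point costs nothing. Let \<open>A\<^sub>i(p)\<close> have radius \<open>\<rho>\<close> and meet a
  picked ball \<open>W\<close> of level \<open>i + 1\<close> and radius \<open>w\<close>. If \<open>2w \<le> (r - 1)\<rho>\<close>, then \<open>W\<close> lies in
  the \<open>r\<close>-enlargement of \<open>A\<^sub>i(p)\<close>, hence in \<open>A\<^sub>i\<^sub>+\<^sub>1(p)\<close>, which was a competitor of \<open>W\<close>; by
  maximality the two agree and \<open>A\<^sub>i(p) \<subseteq> W\<close>. Otherwise \<open>\<rho>\<close> is so small that \<open>A\<^sub>i(p)\<close> is contained
  in the \<open>(1 + 4/(r - 2))\<close>-enlargement of \<open>W\<close> (lemma \<open>ball_absorbed\<close>). In either case \<open>A\<^sub>1(p)\<close> is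
  covered. Restricting the choice to inclusion-maximal balls is what makes this work: a picked ball
  much smaller than \<open>A\<^sub>i(p)\<close> could otherwise block it without covering it.

  This gives (a). For (b) a bound relative to \<open>S\<^sub>n\<close> is too weak, since \<open>S\<^sub>1\<close> may be far smaller;
  instead one keeps track of the ratio between what stays unfilled and what has been filled so far,
  which after \<open>k\<close> levels is at most \<open>q\<^sup>k : (1 - q\<^sup>k)\<close> with \<open>q = (c - 1)/c\<close>.

  The bookkeeping over the levels, lemma \<open>layered_selection\<close>, uses nothing about groups; the
  word metric enters only through \<open>ball_absorbed\<close> and \<open>maximal_ball_selection\<close>.
\<close>

section \<open>Selecting disjoint sets\<close>

text \<open>
  The greedy half of the Vitali covering lemma: take a set of largest size, discard those that meet
  it, and repeat.
\<close>

lemma disjoint_subfamily_meeting_all: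
  fixes pts :: "'b \<Rightarrow> 'a set" and size :: "'b \<Rightarrow> real"
  assumes "finite F" and "\<And>B. B \<in> F \<Longrightarrow> pts B \<noteq> {}"
  shows "\<exists>\<C>\<subseteq>F. disjoint_family_on pts \<C> \<and>
           (\<forall>B\<in>F. \<exists>W\<in>\<C>. pts B \<inter> pts W \<noteq> {} \<and> size B \<le> size W)"
  using assms
proof (induction "card F" arbitrary: F rule: less_induct)
  case less
  show ?case
  proof (cases "F = {}")
    case True
    then show ?thesis by (auto simp: disjoint_family_on_def)
  next
    case False
    define B0 where "B0 = arg_max_on size F"
    have B0: "B0 \<in> F" and largest: "\<And>B. B \<in> F \<Longrightarrow> size B \<le> size B0"
    proof -
      have "Max (size ` F) \<in> size ` F" using False less.prems(1) by simp
      then obtain b where b: "b \<in> F" "size b = Max (size ` F)" by auto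
      have "\<exists>b. is_arg_max size (\<lambda>x. x \<in> F) b"
        using b less.prems(1) by (auto simp: is_arg_max_linorder intro!: exI[of _ b])
      then have "is_arg_max size (\<lambda>x. x \<in> F) B0"
        unfolding B0_def arg_max_on_def arg_max_def by (rule someI_ex)
      then show "B0 \<in> F" "\<And>B. B \<in> F \<Longrightarrow> size B \<le> size B0"
        by (auto simp: is_arg_max_linorder)
    qed
    define F' where "F' = {B \<in> F. pts B \<inter> pts B0 = {}}"
    have "F' \<subset> F" using B0 less.prems(2)[OF B0] by (auto simp: F'_def)
    then have "card F' < card F" using less.prems(1) by (simp add: psubset_card_mono)
    moreover have "finite F'" using less.prems(1) by (simp add: F'_def)
    moreover have "\<And>B. B \<in> F' \<Longrightarrow> pts B \<noteq> {}" using less.prems(2) by (simp add: F'_def)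
    ultimately obtain \<C> where \<C>: "\<C> \<subseteq> F'" "disjoint_family_on pts \<C>"
      "\<forall>B\<in>F'. \<exists>W\<in>\<C>. pts B \<inter> pts W \<noteq> {} \<and> size B \<le> size W"
      using less.hyps[of F'] by blast
    have "disjoint_family_on pts (insert B0 \<C>)"
      using \<C>(1,2) unfolding disjoint_family_on_def F'_def by blast
    moreover have "insert B0 \<C> \<subseteq> F" using B0 \<C>(1) by (auto simp: F'_def)
    moreover have "\<exists>W\<in>insert B0 \<C>. pts B \<inter> pts W \<noteq> {} \<and> size B \<le> size W" if "B \<in> F" for B
    proof (cases "B \<in> F'")
      case True
      then show ?thesis using \<C>(3) by blast
    next
      case False
      then show ?thesis using that largest[OF that] by (auto simp: F'_def)
    qed
    ultimately show ?thesis by (intro exI[of _ "insert B0 \<C>"]) simp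
  qed
qed

text \<open>
  The combinatorial core. Levels are counted from \<open>0\<close>, and \<open>q\<close> bounds the part of a level that one
  selection leaves unfilled. The set \<open>U\<close> is what the enlarged balls may fail to cover. It is
  compared both with the top level and with what has been filled; the second comparison bounds
  the uncovered part of the bottom level even if that level is only a small part of the top one.
\<close>

lemma layered_selection:
  fixes pts E :: "'b \<Rightarrow> 'a set" and A :: "nat \<Rightarrow> 'p \<Rightarrow> 'b" and q :: real
  assumes q: "0 \<le> q" "q \<le> 1"
    and fin: "\<And>i p. i \<le> n \<Longrightarrow> p \<in> X \<Longrightarrow> finite (pts (A i p))"
    and nested: "\<And>i p. i < n \<Longrightarrow> p \<in> X \<Longrightarrow> pts (A i p) \<subseteq> pts (A (Suc i) p)"
    and enlarged: "\<And>i p. i \<le> n \<Longrightarrow> p \<in> X \<Longrightarrow> pts (A i p) \<subseteq> E (A i p)"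
    and absorbed: "\<And>i p p'. i < n \<Longrightarrow> p \<in> X \<Longrightarrow> p' \<in> X \<Longrightarrow>
          pts (A i p) \<inter> pts (A (Suc i) p') \<noteq> {} \<Longrightarrow>
          \<not> pts (A (Suc i) p') \<subset> pts (A (Suc i) p) \<Longrightarrow> pts (A i p) \<subseteq> E (A (Suc i) p')"
    and selection: "\<And>i P. i \<le> n \<Longrightarrow> P \<subseteq> X \<Longrightarrow>
          \<exists>\<C> \<subseteq> A i ` P. disjoint_family_on pts \<C> \<and>
            (\<forall>W\<in>\<C>. \<forall>p\<in>P. \<not> pts W \<subset> pts (A i p)) \<and>
            (1 - q) * card (\<Union>p\<in>P. pts (A i p)) \<le> card (\<Union>W\<in>\<C>. pts W)"
    and X: "finite X" and P: "P \<subseteq> X"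
  shows "\<exists>\<C> U. \<C> \<subseteq> {A i p | i p. i \<le> n \<and> p \<in> P} \<and> disjoint_family_on pts \<C> \<and>
           finite U \<and> (\<Union>p\<in>P. pts (A 0 p)) \<subseteq> U \<union> (\<Union>W\<in>\<C>. E W) \<and>
           card U \<le> q ^ Suc n * card (\<Union>p\<in>P. pts (A n p)) \<and>
           (1 - q ^ Suc n) * card U \<le> q ^ Suc n * card (\<Union>W\<in>\<C>. pts W)"
    (is "\<exists>\<C> U. ?selected n P \<C> U")
  using fin nested enlarged absorbed selection P
proof (induction n arbitrary: P)
  case 0
  let ?V = "\<Union>p\<in>P. pts (A 0 p)"
  obtain \<C> where \<C>: "\<C> \<subseteq> A 0 ` P" "disjoint_family_on pts \<C>"
    "(1 - q) * card ?V \<le> card (\<Union>W\<in>\<C>. pts W)"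
    using "0.prems"(5)[OF _ "0.prems"(6)] by auto
  let ?D = "\<Union>W\<in>\<C>. pts W"
  have finV: "finite ?V" using "0.prems"(1,6) X finite_subset by blast
  have sub: "?D \<subseteq> ?V" using \<C>(1) by auto
  have diff: "real (card (?V - ?D)) = real (card ?V) - real (card ?D)"
    using card_Diff_subset[OF finite_subset[OF sub finV] sub] card_mono[OF finV sub] by simp
  have "real (card (?V - ?D)) \<le> q * card ?V"
    using \<C>(3) unfolding diff by (simp add: algebra_simps)
  moreover have "(1 - q) * card (?V - ?D) \<le> q * card ?D"
    using \<C>(3) unfolding diff by (simp add: algebra_simps)
  moreover have "?V \<subseteq> (?V - ?D) \<union> (\<Union>W\<in>\<C>. E W)"
    using \<C>(1) "0.prems"(3,6) by fastforce
  moreover have "\<C> \<subseteq> {A i p | i p. i \<le> 0 \<and> p \<in> P}" using \<C>(1) by auto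
  ultimately show ?case
    using \<C>(2) finV by (intro exI[of _ \<C>] exI[of _ "?V - ?D"]) simp
next
  case (Suc n)
  let ?V = "\<Union>p\<in>P. pts (A (Suc n) p)"
  obtain \<C> where \<C>: "\<C> \<subseteq> A (Suc n) ` P" "disjoint_family_on pts \<C>"
    "\<forall>W\<in>\<C>. \<forall>p\<in>P. \<not> pts W \<subset> pts (A (Suc n) p)"
    "(1 - q) * card ?V \<le> card (\<Union>W\<in>\<C>. pts W)"
    using Suc.prems(5)[OF le_refl Suc.prems(6)] by blast
  let ?D = "\<Union>W\<in>\<C>. pts W"
  define P' where "P' = {p \<in> P. pts (A n p) \<inter> ?D = {}}"
  let ?V' = "\<Union>p\<in>P'. pts (A n p)"
  have P': "P' \<subseteq> P" "P' \<subseteq> X" using Suc.prems(6) by (auto simp: P'_def)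
  have "\<exists>\<C>' U. ?selected n P' \<C>' U"
    by (rule Suc.IH[OF _ _ _ _ _ P'(2)]) (rule Suc.prems(1-5); simp)+
  then obtain \<C>' U where IH: "\<C>' \<subseteq> {A i p | i p. i \<le> n \<and> p \<in> P'}" "disjoint_family_on pts \<C>'"
    "finite U" "(\<Union>p\<in>P'. pts (A 0 p)) \<subseteq> U \<union> (\<Union>W\<in>\<C>'. E W)"
    "card U \<le> q ^ Suc n * card ?V'"
    "(1 - q ^ Suc n) * card U \<le> q ^ Suc n * card (\<Union>W\<in>\<C>'. pts W)"
    by blast
  let ?D' = "\<Union>W\<in>\<C>'. pts W"
  have below: "pts (A i p) \<subseteq> pts (A n p)" if "i \<le> n" "p \<in> X" for i p
    using that(1)
  proof (induction rule: inc_induct)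
    case (step m)
    then show ?case using Suc.prems(2)[of m p] that(2) by auto
  qed simp
  have finV: "finite ?V" using Suc.prems(1,6) X finite_subset by blast
  have sub: "?D \<subseteq> ?V" using \<C>(1) by auto
  have finD: "finite ?D" using finite_subset[OF sub finV] .
  have sub': "?D' \<subseteq> ?V'" using IH(1) below P'(2) by fastforce
  have V': "?V' \<subseteq> ?V - ?D" using Suc.prems(2)[of n] P' by (auto simp: P'_def)
  have finD': "finite ?D'" using sub' V' finV by (meson finite_Diff finite_subset)
  have DD': "?D \<inter> ?D' = {}" using sub' V' by blast
  have v: "real (card ?V') \<le> real (card ?V) - real (card ?D)"
  proof -
    have "card ?V' \<le> card (?V - ?D)" using V' finV by (intro card_mono) simp_all
    moreover have "card (?V - ?D) = card ?V - card ?D" by (rule card_Diff_subset[OF finD sub])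
    moreover have "card ?D \<le> card ?V" by (rule card_mono[OF finV sub])
    ultimately show ?thesis by linarith
  qed
  have "disjoint_family_on pts (\<C> \<union> \<C>')"
    using \<C>(2) IH(2) DD' unfolding disjoint_family_on_def by blast
  moreover have "\<C> \<union> \<C>' \<subseteq> {A i p | i p. i \<le> Suc n \<and> p \<in> P}"
    using \<C>(1) IH(1) P'(1) by fastforce
  moreover have "(\<Union>p\<in>P. pts (A 0 p)) \<subseteq> U \<union> (\<Union>W\<in>\<C> \<union> \<C>'. E W)"
  proof (rule UN_least)
    fix p assume p: "p \<in> P"
    show "pts (A 0 p) \<subseteq> U \<union> (\<Union>W\<in>\<C> \<union> \<C>'. E W)"
    proof (cases "p \<in> P'")
      case True
      then show ?thesis using IH(4) by blast
    next
      case False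
      then obtain W where W: "W \<in> \<C>" "pts (A n p) \<inter> pts W \<noteq> {}" using p by (auto simp: P'_def)
      obtain p' where p': "p' \<in> P" "W = A (Suc n) p'" using W(1) \<C>(1) by auto
      \<comment> \<open>As \<open>p \<in> P\<close>, its ball one level up competed with \<open>W\<close>, so \<open>W\<close> is not properly inside it.\<close>
      have "pts (A n p) \<subseteq> E W"
        using Suc.prems(4)[of n p p'] W \<C>(3) p p' Suc.prems(6) by blast
      moreover have "pts (A 0 p) \<subseteq> pts (A n p)" using below[of 0 p] p Suc.prems(6) by blast
      ultimately show ?thesis using W(1) by blast
    qed
  qed
  moreover have "card U \<le> q ^ Suc (Suc n) * card ?V"
  proof -
    have "card ?V' \<le> q * card ?V" using v \<C>(4) by (simp add: algebra_simps)
    then have "q ^ Suc n * card ?V' \<le> q ^ Suc n * (q * card ?V)"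
      using q by (intro mult_left_mono) auto
    then show ?thesis using IH(5) by (simp add: algebra_simps)
  qed
  moreover have "(1 - q ^ Suc (Suc n)) * card U \<le> q ^ Suc (Suc n) * card (\<Union>W\<in>\<C> \<union> \<C>'. pts W)"
  proof -
    have card: "card (\<Union>W\<in>\<C> \<union> \<C>'. pts W) = card ?D + card ?D'"
      using card_Un_disjoint[OF finD finD' DD'] by (simp add: UN_Un)
    have "(1 - q) * card ?V' \<le> (1 - q) * (real (card ?V) - card ?D)"
      using v q by (intro mult_left_mono) auto
    then have "(1 - q) * card ?V' \<le> q * card ?D" using \<C>(4) by (simp add: algebra_simps)
    then have "q ^ Suc n * ((1 - q) * card ?V') \<le> q ^ Suc n * (q * card ?D)"
      using q by (intro mult_left_mono) auto
    moreover have "(1 - q) * card U \<le> (1 - q) * (q ^ Suc n * card ?V')"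
      using IH(5) q by (intro mult_left_mono) auto
    moreover have "q * ((1 - q ^ Suc n) * card U) \<le> q * (q ^ Suc n * card ?D')"
      using IH(6) q by (intro mult_left_mono) auto
    ultimately show ?thesis unfolding card by (simp add: algebra_simps)
  qed
  ultimately show ?case using IH(3) by (intro exI[of _ "\<C> \<union> \<C>'"] exI[of _ U] conjI)
qed

section \<open>The word metric\<close>

locale generated_group = group G for G (structure) +
  fixes gens :: "'a set"
  assumes gens_sub: "gens \<subseteq> carrier G" and generates: "generate G gens = carrier G"
begin

abbreviation words :: "'a \<Rightarrow> ('a \<times> int) list set" where
  "words x \<equiv> {w. fst ` set w \<subseteq> gens \<and> word_val G w = x}"

lemma word_val_closed: "fst ` set w \<subseteq> gens \<Longrightarrow> word_val G w \<in> carrier G"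
  using gens_sub by (induction w) (auto simp: word_val_def)

lemma word_val_append:
  "fst ` set v \<subseteq> gens \<Longrightarrow> fst ` set w \<subseteq> gens \<Longrightarrow>
     word_val G (v @ w) = word_val G v \<otimes> word_val G w"
proof (induction v)
  case Nil
  then show ?case using word_val_closed[of w] by (simp add: word_val_def)
next
  case (Cons a v)
  obtain g p where a: "a = (g, p)" by force
  have "g \<in> carrier G" using Cons.prems(1) gens_sub by (auto simp: a)
  then show ?case
    using Cons word_val_closed[of w] word_val_closed[of v]
    by (simp add: a word_val_def m_assoc)
qed

lemma word_val_reverse:
  "fst ` set w \<subseteq> gens \<Longrightarrow>
     word_val G (rev (map (\<lambda>(g, p). (g, - p)) w)) = inv (word_val G w)"
proof (induction w)
  case Nil
  then show ?case by (simp add: word_val_def)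
next
  case (Cons a w)
  obtain g p where a: "a = (g, p)" by force
  have g: "g \<in> carrier G" "g \<in> gens" using Cons.prems gens_sub by (auto simp: a)
  have "word_val G (rev (map (\<lambda>(g, p). (g, - p)) (a # w)))
      = inv (word_val G w) \<otimes> word_val G [(g, - p)]"
  proof -
    have "fst ` set (rev (map (\<lambda>(g, p). (g, - p)) w)) \<subseteq> gens" using Cons.prems by force
    then show ?thesis using Cons g word_val_append[of _ "[(g, - p)]"] by (simp add: a)
  qed
  then show ?case
    using Cons.prems g word_val_closed[of w]
    by (simp add: a word_val_def int_pow_neg inv_mult_group)
qed

lemma words_nonempty: "x \<in> carrier G \<Longrightarrow> words x \<noteq> {}"
proof -
  assume "x \<in> carrier G"
  then have "x \<in> generate G gens" by (simp add: generates)
  then show ?thesis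
  proof induction
    case one
    have "[] \<in> words \<one>" by (simp add: word_val_def)
    then show ?case by blast
  next
    case (incl h)
    then have "[(h, 1)] \<in> words h" using gens_sub by (auto simp: word_val_def int_pow_1)
    then show ?case by blast
  next
    case (inv h)
    then have "[(h, -1)] \<in> words (inv h)"
      using gens_sub by (auto simp: word_val_def int_pow_neg int_pow_1)
    then show ?case by blast
  next
    case (eng g h)
    then obtain v w where "v \<in> words g" "w \<in> words h" by blast
    then have "v @ w \<in> words (g \<otimes> h)" using word_val_append[of v w] by auto
    then show ?case by blast
  qed
qed

lemma word_norm_le: "w \<in> words x \<Longrightarrow> word_norm G gens x \<le> word_weight w"
  unfolding word_norm_def by (intro cINF_lower) auto

lemma word_norm_attained:
  assumes "x \<in> carrier G"
  obtains w where "w \<in> words x" "word_norm G gens x = word_weight w"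
  using Inf_nat_def1[of "word_weight ` words x"] words_nonempty[OF assms] that
  unfolding word_norm_def by blast

lemma word_norm_one: "word_norm G gens \<one> = 0"
  using word_norm_le[of "[]" \<one>] by (simp add: word_val_def word_weight_def)

lemma word_norm_mult:
  assumes "x \<in> carrier G" "y \<in> carrier G"
  shows "word_norm G gens (x \<otimes> y) \<le> word_norm G gens x + word_norm G gens y"
proof -
  obtain v where v: "v \<in> words x" "word_norm G gens x = word_weight v"
    using assms(1) by (rule word_norm_attained)
  obtain w where w: "w \<in> words y" "word_norm G gens y = word_weight w"
    using assms(2) by (rule word_norm_attained)
  have "v @ w \<in> words (x \<otimes> y)" using word_val_append[of v w] v(1) w(1) by auto
  then have "word_norm G gens (x \<otimes> y) \<le> word_weight (v @ w)" by (rule word_norm_le)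
  then show ?thesis unfolding v(2) w(2) by (simp add: word_weight_def)
qed

lemma word_norm_inv_le:
  assumes "x \<in> carrier G"
  shows "word_norm G gens (inv x) \<le> word_norm G gens x"
proof -
  obtain w where w: "w \<in> words x" "word_norm G gens x = word_weight w"
    using assms by (rule word_norm_attained)
  let ?w = "rev (map (\<lambda>(g, p). (g, - p)) w)"
  have "fst ` set ?w = fst ` set w" by force
  then have "?w \<in> words (inv x)" using word_val_reverse[of w] w(1) by auto
  moreover have "word_weight ?w = word_weight w"
    unfolding word_weight_def
    by (simp add: rev_map[symmetric] sum_list_rev comp_def case_prod_unfold)
  ultimately show ?thesis using word_norm_le[of ?w "inv x"] w(2) by metis
qed

lemma word_norm_inv: "x \<in> carrier G \<Longrightarrow> word_norm G gens (inv x) = word_norm G gens x"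
  using word_norm_inv_le[of x] word_norm_inv_le[of "inv x"] by simp

lemma word_dist_refl: "x \<in> carrier G \<Longrightarrow> word_dist G gens x x = 0"
  by (simp add: word_dist_def word_norm_one)

lemma word_dist_sym:
  "x \<in> carrier G \<Longrightarrow> y \<in> carrier G \<Longrightarrow> word_dist G gens x y = word_dist G gens y x"
  using word_norm_inv[of "x \<otimes> inv y"] by (simp add: word_dist_def inv_mult_group)

lemma word_dist_triangle:
  assumes "x \<in> carrier G" "y \<in> carrier G" "z \<in> carrier G"
  shows "word_dist G gens x z \<le> word_dist G gens x y + word_dist G gens y z"
proof -
  have "(x \<otimes> inv y) \<otimes> (y \<otimes> inv z) = x \<otimes> inv z"
    using assms by (simp add: m_assoc) (simp add: m_assoc[symmetric])
  then show ?thesis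
    using word_norm_mult[of "x \<otimes> inv y" "y \<otimes> inv z"] assms by (simp add: word_dist_def)
qed

section \<open>Balls\<close>

lemma center_in_ball: "x \<in> carrier G \<Longrightarrow> 0 \<le> t \<Longrightarrow> x \<in> word_ball G gens x t"
  by (simp add: word_ball_def word_dist_refl)

lemma ball_mono: "s \<le> t \<Longrightarrow> word_ball G gens x s \<subseteq> word_ball G gens x t"
  by (auto simp: word_ball_def)

lemma ball_floor: "0 \<le> t \<Longrightarrow> word_ball G gens x t = word_ball G gens x (nat \<lfloor>t\<rfloor>)"
  unfolding word_ball_def
  by (metis (no_types, lifting) le_nat_floor of_nat_floor of_nat_le_iff order_trans)

text \<open>Two balls that meet have centers at distance at most the sum of the radii.\<close>

lemma ball_subset_ball_if_meet:
  assumes "x \<in> carrier G" "y \<in> carrier G"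
    and "word_ball G gens x s \<inter> word_ball G gens y t \<noteq> {}"
    and "2 * s + t \<le> u"
  shows "word_ball G gens x s \<subseteq> word_ball G gens y u"
proof
  fix v assume v: "v \<in> word_ball G gens x s"
  obtain z where z: "z \<in> word_ball G gens x s" "z \<in> word_ball G gens y t" using assms(3) by blast
  have c: "z \<in> carrier G" "v \<in> carrier G" using v z by (auto simp: word_ball_def)
  have "word_dist G gens y v \<le> word_dist G gens y z + (word_dist G gens z x + word_dist G gens x v)"
    using word_dist_triangle[of y z v] word_dist_triangle[of z x v] c assms(1,2) by linarith
  moreover have "real (word_dist G gens y z) \<le> t" "real (word_dist G gens z x) \<le> s"
    "real (word_dist G gens x v) \<le> s"
    using z v word_dist_sym[of z x] c assms(1) by (auto simp: word_ball_def)
  ultimately show "v \<in> word_ball G gens y u" using c assms(4) by (auto simp: word_ball_def)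
qed

text \<open>Right translation by \<open>x\<close> is an isometry carrying the ball at \<open>\<one>\<close> to the ball at \<open>x\<close>.\<close>

lemma bij_betw_ball_one:
  assumes x: "x \<in> carrier G"
  shows "bij_betw (\<lambda>y. y \<otimes> x) (word_ball G gens \<one> t) (word_ball G gens x t)"
proof (rule bij_betw_byWitness[where f' = "\<lambda>y. y \<otimes> inv x"])
  have eq: "word_dist G gens x (y \<otimes> x) = word_dist G gens \<one> y" if "y \<in> carrier G" for y
    using that x by (simp add: word_dist_def inv_mult_group m_assoc[symmetric])
  show "(\<lambda>y. y \<otimes> x) ` word_ball G gens \<one> t \<subseteq> word_ball G gens x t"
    using x eq by (auto simp: word_ball_def)
  show "(\<lambda>y. y \<otimes> inv x) ` word_ball G gens x t \<subseteq> word_ball G gens \<one> t"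
  proof (rule image_subsetI)
    fix y assume y: "y \<in> word_ball G gens x t"
    then have "(y \<otimes> inv x) \<otimes> x = y" using x by (simp add: word_ball_def m_assoc)
    then show "y \<otimes> inv x \<in> word_ball G gens \<one> t"
      using x y eq[of "y \<otimes> inv x"] by (simp add: word_ball_def)
  qed
qed (use x in \<open>auto simp: word_ball_def m_assoc\<close>)

lemma card_ball: "x \<in> carrier G \<Longrightarrow> card (word_ball G gens x (real m)) = growth G gens m"
  unfolding growth_def using bij_betw_same_card[OF bij_betw_ball_one] by metis

text \<open>
  A ball that meets \<open>W\<close> without \<open>W\<close> lying properly inside the next ball of the same point is
  swallowed by a slight enlargement of \<open>W\<close>: its radius is less than \<open>2/(r - 1)\<close> times that of \<open>W\<close>
  as soon as its \<open>r\<close>-enlargement fails to contain \<open>W\<close>.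
\<close>

lemma ball_absorbed:
  assumes "is_wball G B" "is_wball G W" and r: "r > (2::real)"
    and meet: "points G gens B \<inter> points G gens W \<noteq> {}"
    and next_ball: "points G gens (enlarge r B) \<subseteq> N" "\<not> points G gens W \<subset> N"
  shows "points G gens B \<subseteq> points G gens (enlarge (1 + 4 / (r - 2)) W)"
proof -
  let ?\<rho> = "snd B" and ?w = "snd W"
  have c: "fst B \<in> carrier G" "fst W \<in> carrier G" "0 \<le> ?\<rho>" "0 \<le> ?w"
    using assms(1,2) by (auto simp: is_wball_def)
  have pts: "points G gens V = word_ball G gens (fst V) (snd V)"
    and enl: "points G gens (enlarge t V) = word_ball G gens (fst V) (t * snd V)" for t V
    by (simp_all add: points_def enlarge_def)
  show ?thesis
  proof (cases "2 * ?w + ?\<rho> \<le> r * ?\<rho>")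
    case True
    have "points G gens W \<subseteq> points G gens (enlarge r B)"
      unfolding pts[of W] enl[of r B]
      using ball_subset_ball_if_meet[OF c(2,1) _ True] meet unfolding pts by (simp add: Int_commute)
    then have "points G gens W = N" using next_ball by blast
    moreover have "?\<rho> \<le> r * ?\<rho>" using r c mult_right_mono[of 1 r ?\<rho>] by simp
    then have "points G gens B \<subseteq> N"
      using next_ball(1) ball_mono unfolding pts[of B] enl[of r B] by (meson subset_trans)
    moreover have "?w \<le> (1 + 4 / (r - 2)) * ?w"
      using r c mult_right_mono[of 1 "1 + 4 / (r - 2)" ?w] by simp
    then have "points G gens W \<subseteq> points G gens (enlarge (1 + 4 / (r - 2)) W)"
      unfolding pts[of W] enl by (rule ball_mono)
    ultimately show ?thesis by simp
  next
    case False
    then have "(r - 2) * ?\<rho> \<le> 2 * ?w" using c by (simp add: algebra_simps)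
    then have "?\<rho> \<le> 2 * ?w / (r - 2)" using r by (simp add: pos_le_divide_eq mult.commute)
    then have "2 * ?\<rho> + ?w \<le> (1 + 4 / (r - 2)) * ?w" by (simp add: distrib_right)
    from ball_subset_ball_if_meet[OF c(1,2) _ this] meet
    show ?thesis unfolding pts[of B] pts[of W] enl by blast
  qed
qed

text \<open>
  The Vitali covering lemma, run on the balls that are maximal for inclusion. Tripling is done after
  rounding the radius down, because the growth is controlled at integers only.
\<close>

lemma maximal_ball_selection:
  fixes c :: real
  assumes fin: "\<And>m. finite (word_ball G gens \<one> (real m))"
    and tripling: "\<And>m. real (growth G gens (3 * m)) \<le> c * real (growth G gens m)"
    and F: "finite F" "\<And>B. B \<in> F \<Longrightarrow> is_wball G B"
  shows "\<exists>\<C>\<subseteq>F. disjoint_family_on (points G gens) \<C> \<and>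
           (\<forall>W\<in>\<C>. \<forall>B\<in>F. \<not> points G gens W \<subset> points G gens B) \<and>
           card (\<Union>B\<in>F. points G gens B) \<le> c * card (\<Union>W\<in>\<C>. points G gens W)"
proof -
  let ?pts = "points G gens"
  have finite_ball: "finite (word_ball G gens x (real m))" if "x \<in> carrier G" for x m
    using bij_betw_finite[OF bij_betw_ball_one[OF that]] fin by blast
  define M where "M = {B \<in> F. \<forall>B'\<in>F. \<not> ?pts B \<subset> ?pts B'}"
  have M: "finite M" "\<And>B. B \<in> M \<Longrightarrow> is_wball G B" "M \<subseteq> F"
    using F by (auto simp: M_def)
  have nonempty: "?pts B \<noteq> {}" if "B \<in> M" for B
    using M(2)[OF that] center_in_ball by (force simp: points_def is_wball_def)
  have "\<exists>\<C>\<subseteq>M. disjoint_family_on ?pts \<C> \<and>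
      (\<forall>B\<in>M. \<exists>W\<in>\<C>. ?pts B \<inter> ?pts W \<noteq> {} \<and> snd B \<le> snd W)"
    by (rule disjoint_subfamily_meeting_all[OF M(1) nonempty])
  then obtain \<C> where \<C>: "\<C> \<subseteq> M" "disjoint_family_on ?pts \<C>"
    "\<forall>B\<in>M. \<exists>W\<in>\<C>. ?pts B \<inter> ?pts W \<noteq> {} \<and> snd B \<le> snd W"
    by blast
  define rad :: "'a wball \<Rightarrow> nat" where "rad B = nat \<lfloor>snd B\<rfloor>" for B
  define T where "T W = word_ball G gens (fst W) (real (3 * rad W))" for W :: "'a wball"
  have pts: "fst B \<in> carrier G" "?pts B = word_ball G gens (fst B) (real (rad B))"
    if "is_wball G B" for B
    using that ball_floor[of "snd B" "fst B"] by (auto simp: points_def is_wball_def rad_def)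
  have ball: "is_wball G W" if "W \<in> \<C>" for W using \<C>(1) M(2) that by blast
  have "?pts B \<subseteq> (\<Union>W\<in>\<C>. T W)" if "B \<in> F" for B
  proof -
    \<comment> \<open>Enlarge \<open>B\<close> to an inclusion-maximal ball, which meets a selected ball of no smaller radius.\<close>
    have "finite (?pts ` F)" "?pts B \<in> ?pts ` F" using F(1) that by auto
    from finite_has_maximal2[OF this]
    obtain S where S: "S \<in> ?pts ` F" "?pts B \<subseteq> S" "\<And>S'. S' \<in> ?pts ` F \<Longrightarrow> S \<subseteq> S' \<Longrightarrow> S = S'"
      by metis
    then obtain B' where "B' \<in> F" "S = ?pts B'" by blast
    with S have B': "B' \<in> M" "?pts B \<subseteq> ?pts B'" unfolding M_def by blast+
    obtain W where W: "W \<in> \<C>" "?pts B' \<inter> ?pts W \<noteq> {}" "snd B' \<le> snd W" using \<C>(3) B'(1) by blast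
    have "rad B' \<le> rad W" using W(3) by (simp add: rad_def floor_mono nat_mono)
    then have "?pts B' \<subseteq> T W"
      using ball_subset_ball_if_meet[of "fst B'" "fst W" "rad B'" "rad W" "3 * rad W"]
        W(2) pts[OF M(2)[OF B'(1)]] pts[OF ball[OF W(1)]]
      by (simp add: T_def)
    then show ?thesis using B'(2) W(1) by blast
  qed
  then have cover: "(\<Union>B\<in>F. ?pts B) \<subseteq> (\<Union>W\<in>\<C>. T W)" by blast
  have fin\<C>: "finite \<C>" using \<C>(1) M(1) finite_subset by blast
  have T: "finite (T W)" "real (card (T W)) \<le> c * card (?pts W)" if "W \<in> \<C>" for W
    using pts[OF ball[OF that]] finite_ball tripling card_ball by (simp_all add: T_def del: of_nat_mult)
  have "card (\<Union>B\<in>F. ?pts B) \<le> card (\<Union>W\<in>\<C>. T W)" using cover T(1) fin\<C> by (intro card_mono) auto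
  also have "\<dots> \<le> (\<Sum>W\<in>\<C>. card (T W))" using fin\<C> by (rule card_UN_le)
  finally have "real (card (\<Union>B\<in>F. ?pts B)) \<le> (\<Sum>W\<in>\<C>. real (card (T W)))"
    by (simp flip: of_nat_sum)
  also have "\<dots> \<le> (\<Sum>W\<in>\<C>. c * card (?pts W))" using T(2) by (intro sum_mono)
  also have "\<dots> = c * card (\<Union>W\<in>\<C>. ?pts W)"
  proof -
    have "card (\<Union>W\<in>\<C>. ?pts W) = (\<Sum>W\<in>\<C>. card (?pts W))"
      using \<C>(2) fin\<C> pts[OF ball] finite_ball
      by (intro card_UN_disjoint) (auto simp: disjoint_family_on_def)
    then show ?thesis by (simp add: sum_distrib_left)
  qed
  finally have "real (card (\<Union>B\<in>F. ?pts B)) \<le> c * card (\<Union>W\<in>\<C>. ?pts W)" .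
  moreover have "\<forall>W\<in>\<C>. \<forall>B\<in>F. \<not> ?pts W \<subset> ?pts B" using \<C>(1) unfolding M_def by blast
  moreover have "\<C> \<subseteq> F" using \<C>(1) M(3) by (rule subset_trans)
  ultimately show ?thesis using \<C>(2) by (metis (no_types, lifting))
qed

end

text \<open>A positive lower growth bound already forces finite balls, infinite sets having cardinality \<open>0\<close>.\<close>

lemma finite_ball_of_growth_bounds:
  assumes "growth_bounds G gens d C" "C \<ge> 1"
  shows "finite (word_ball G gens \<one>\<^bsub>G\<^esub> (real m))"
proof -
  have "0 < 1 / C * real (Suc m) ^ d" using assms(2) by simp
  also have "\<dots> \<le> growth G gens (Suc m)"
    using assms(1) le_add1[of 1 m] unfolding growth_bounds_def plus_1_eq_Suc by blast
  finally have "finite (word_ball G gens \<one>\<^bsub>G\<^esub> (real (Suc m)))"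
    unfolding growth_def by (simp only: of_nat_0_less_iff card_gt_0_iff)
  moreover have "word_ball G gens \<one>\<^bsub>G\<^esub> (real m) \<subseteq> word_ball G gens \<one>\<^bsub>G\<^esub> (real (Suc m))"
    unfolding word_ball_def by fastforce
  ultimately show ?thesis by (rule finite_subset[rotated])
qed

lemma growth_tripling:
  assumes "growth_bounds G gens d C" "C \<ge> 1"
  shows "real (growth G gens (3 * m)) \<le> 3 ^ d * C\<^sup>2 * real (growth G gens m)"
proof (cases "m = 0")
  case True
  have "1 \<le> 3 ^ d * C\<^sup>2" using assms(2) mult_mono[of 1 "3 ^ d" 1 "C\<^sup>2"] by simp
  then show ?thesis using True mult_right_mono[of 1 "3 ^ d * C\<^sup>2" "growth G gens 0"] by simp
next
  case False
  have "real (growth G gens (3 * m)) \<le> C * real (3 * m) ^ d"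
  proof -
    have "1 \<le> 3 * m" using False by simp
    then show ?thesis using assms(1) unfolding growth_bounds_def by blast
  qed
  also have "\<dots> = 3 ^ d * C\<^sup>2 * (1 / C * real m ^ d)"
    using assms(2) by (simp add: power_mult_distrib power2_eq_square)
  also have "\<dots> \<le> 3 ^ d * C\<^sup>2 * growth G gens m"
  proof (rule mult_left_mono)
    have "1 \<le> m" using False by simp
    then show "1 / C * real m ^ d \<le> growth G gens m"
      using assms(1) unfolding growth_bounds_def by blast
  qed simp
  finally show ?thesis .
qed

section \<open>The covering theorem\<close>

theorem theorem2p9:
  fixes G :: "('a, 'm) monoid_scheme"
    and gens X :: "'a set"
    and d R n r :: nat
    and C c :: real
    and A :: "nat \<Rightarrow> 'a \<Rightarrow> 'a wball"
    and S :: "nat \<Rightarrow> 'a set"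
  assumes "group G"
    and "finite gens" and "gens \<subseteq> carrier G" and "generate G gens = carrier G"
    and "polynomial_growth_of_degree G gens d"
    and "C \<ge> 1" and "growth_bounds G gens d C"
    and c: "c = 3 ^ d * C\<^sup>2"
    and "R \<ge> 1" and "n \<ge> 1" and "r > 2"
    and "X \<subseteq> word_ball G gens \<one>\<^bsub>G\<^esub> (real R)"
    and "\<And>p i. p \<in> X \<Longrightarrow> i \<in> {1..n} \<Longrightarrow> is_wball G (A i p)"
    and i: "\<And>p i. p \<in> X \<Longrightarrow> i \<in> {1..n} \<Longrightarrow>
          p \<in> points G gens (A i p) \<and> points G gens (A i p) \<subseteq> word_ball G gens \<one>\<^bsub>G\<^esub> (real R)"
    and ii: "\<And>p i. p \<in> X \<Longrightarrow> i \<in> {1..<n} \<Longrightarrow>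
          points G gens (enlarge (real r) (A i p)) \<subseteq> points G gens (A (i + 1) p)"
    and S: "\<And>i. i \<in> {1..n} \<Longrightarrow> S i = (\<Union>p\<in>X. points G gens (A i p))"
  shows "\<exists>\<C> \<subseteq> {A i p | i p. i \<in> {1..n} \<and> p \<in> X}.
           disjoint_family_on (points G gens) \<C> \<and>
           real (card (S n - ((S n - S 1) \<union>
               (\<Union>W\<in>\<C>. points G gens (enlarge (1 + 4 / (real r - 2)) W)))))
             \<le> ((c - 1) / c) ^ n * real (card (S n)) \<and>
           real (card (\<Union>W\<in>\<C>. points G gens (enlarge (1 + 4 / (real r - 2)) W)))
             \<ge> (1 - ((c - 1) / c) ^ n) * real (card (S 1))"
proof -
  interpret generated_group G gens
    using assms(1,3,4) by (simp add: generated_group_def generated_group_axioms_def)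
  let ?pts = "points G gens"
  let ?t = "1 + 4 / (real r - 2)"
  let ?E = "\<lambda>W. ?pts (enlarge ?t W)"
  let ?A = "\<lambda>k. A (Suc k)"
  define q where "q = (c - 1) / c"
  have c1: "c \<ge> 1" using c \<open>C \<ge> 1\<close> mult_mono[of 1 "3 ^ d" 1 "C\<^sup>2"] by simp
  then have q: "0 \<le> q" "q \<le> 1" and q_c: "1 - q = 1 / c"
    by (auto simp: q_def field_simps)
  obtain N where N: "n = Suc N" using \<open>n \<ge> 1\<close> by (cases n) auto
  note wball = assms(13)
  have fin_ball: "finite (word_ball G gens \<one>\<^bsub>G\<^esub> (real m))" for m
    using finite_ball_of_growth_bounds assms(6,7) by blast
  have finX: "finite X" using finite_subset[OF assms(12) fin_ball] .
  have fin_pts: "finite (?pts B)" if "is_wball G B" for B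
    using that fin_ball bij_betw_finite[OF bij_betw_ball_one[of "fst B"]] ball_floor[of "snd B" "fst B"]
    unfolding points_def is_wball_def by metis
  have t1: "?t \<ge> 1" using \<open>r > 2\<close> by simp
  have enl: "is_wball G (enlarge ?t B)" "?pts B \<subseteq> ?E B" if "is_wball G B" for B
    using that t1 mult_right_mono[OF t1, of "snd B"] ball_mono[of "snd B" "?t * snd B" "fst B"]
    by (auto simp: is_wball_def enlarge_def points_def)
  have ii': "?pts (enlarge (real r) (?A k p)) \<subseteq> ?pts (?A (Suc k) p)" if "k < N" "p \<in> X" for k p
    using ii[of p "Suc k"] that by (simp add: N)
  have nested: "?pts (?A k p) \<subseteq> ?pts (?A (Suc k) p)" if "k < N" "p \<in> X" for k p
  proof -
    have "0 \<le> snd (?A k p)" using wball[of p "Suc k"] that by (simp add: N is_wball_def)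
    then have "snd (?A k p) \<le> r * snd (?A k p)"
      using \<open>r > 2\<close> mult_right_mono[of 1 r "snd (?A k p)"] by simp
    then show ?thesis
      using ii'[OF that] ball_mono[of "snd (?A k p)" "r * snd (?A k p)" "fst (?A k p)"]
      by (auto simp: points_def enlarge_def)
  qed
  have absorbed: "?pts (?A k p) \<subseteq> ?E (?A (Suc k) p')"
    if "k < N" "p \<in> X" "p' \<in> X" "?pts (?A k p) \<inter> ?pts (?A (Suc k) p') \<noteq> {}"
      "\<not> ?pts (?A (Suc k) p') \<subset> ?pts (?A (Suc k) p)" for k p p'
    using ball_absorbed[OF wball wball _ that(4) ii'[OF that(1,2)] that(5)] that \<open>r > 2\<close> by (simp add: N)
  have selection: "\<exists>\<C>\<subseteq>?A k ` P. disjoint_family_on ?pts \<C> \<and>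
        (\<forall>W\<in>\<C>. \<forall>p\<in>P. \<not> ?pts W \<subset> ?pts (?A k p)) \<and>
        (1 - q) * card (\<Union>p\<in>P. ?pts (?A k p)) \<le> card (\<Union>W\<in>\<C>. ?pts W)"
    if "k \<le> N" "P \<subseteq> X" for k P
  proof -
    have "finite (?A k ` P)" using finX that(2) finite_subset by blast
    moreover have "\<And>B. B \<in> ?A k ` P \<Longrightarrow> is_wball G B" using wball that by (auto simp: N)
    ultimately obtain \<C> where \<C>: "\<C> \<subseteq> ?A k ` P" "disjoint_family_on ?pts \<C>"
      "\<forall>W\<in>\<C>. \<forall>B\<in>?A k ` P. \<not> ?pts W \<subset> ?pts B"
      "card (\<Union>B\<in>?A k ` P. ?pts B) \<le> c * card (\<Union>W\<in>\<C>. ?pts W)"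
      using maximal_ball_selection[of c] fin_ball growth_tripling[OF assms(7,6)] c by meson
    have "(1 - q) * card (\<Union>p\<in>P. ?pts (?A k p)) \<le> card (\<Union>W\<in>\<C>. ?pts W)"
      using \<C>(4) c1 by (simp add: q_c pos_divide_le_eq mult.commute)
    then show ?thesis using \<C>(1-3) by blast
  qed
  \<comment> \<open>Level \<open>k\<close> of the selection is level \<open>k + 1\<close> of the theorem, so that \<open>n = N + 1\<close> levels are used.\<close>
  obtain \<C> U where \<C>: "\<C> \<subseteq> {?A k p | k p. k \<le> N \<and> p \<in> X}" "disjoint_family_on ?pts \<C>"
    and U: "finite U" "(\<Union>p\<in>X. ?pts (?A 0 p)) \<subseteq> U \<union> (\<Union>W\<in>\<C>. ?E W)"
      "card U \<le> q ^ Suc N * card (\<Union>p\<in>X. ?pts (?A N p))"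
      "(1 - q ^ Suc N) * card U \<le> q ^ Suc N * card (\<Union>W\<in>\<C>. ?pts W)"
    using layered_selection[where pts = ?pts and E = ?E and A = ?A and n = N and X = X and P = X,
        OF q fin_pts[OF wball] nested enl(2)[OF wball] absorbed selection finX subset_refl]
    by (auto simp: N)
  let ?D = "\<Union>W\<in>\<C>. ?pts W" and ?EE = "\<Union>W\<in>\<C>. ?E W"
  have balls: "is_wball G W" if "W \<in> \<C>" for W using \<C>(1) that wball by (fastforce simp: N)
  have fin\<C>: "finite \<C>"
  proof -
    have "\<C> \<subseteq> (\<lambda>(k, p). ?A k p) ` ({..N} \<times> X)" using \<C>(1) by force
    then show ?thesis using finX finite_subset by blast
  qed
  have finE: "finite ?EE" using fin\<C> fin_pts[OF enl(1)[OF balls]] by blast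
  have S1: "S 1 \<subseteq> U \<union> ?EE" and Sn: "S n = (\<Union>p\<in>X. ?pts (?A N p))"
    using U(2) S[of 1] S[of n] by (simp_all add: N)
  have "card (S n - ((S n - S 1) \<union> ?EE)) \<le> card U"
    using S1 U(1) by (intro card_mono) auto
  then have a: "real (card (S n - ((S n - S 1) \<union> ?EE))) \<le> ((c - 1) / c) ^ n * card (S n)"
    using U(3) unfolding Sn[symmetric] by (simp add: q_def N)
  have b: "(1 - ((c - 1) / c) ^ n) * card (S 1) \<le> card ?EE"
  proof -
    have "card (S 1) \<le> card (U \<union> ?EE)" using S1 U(1) finE by (intro card_mono) auto
    also have "\<dots> \<le> card U + card ?EE" by (rule card_Un_le)
    finally have "real (card (S 1)) \<le> real (card U) + card ?EE" by linarith
    then have "(1 - q ^ n) * card (S 1) \<le> (1 - q ^ n) * (real (card U) + card ?EE)"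
      using q by (intro mult_left_mono) (auto simp: power_le_one)
    also have "\<dots> = (1 - q ^ n) * card U + (1 - q ^ n) * card ?EE" by (simp add: algebra_simps)
    also have "(1 - q ^ n) * card U \<le> q ^ n * card ?EE"
    proof -
      have "card ?D \<le> card ?EE" using enl(2)[OF balls] finE by (intro card_mono) blast+
      then have "q ^ n * card ?D \<le> q ^ n * card ?EE" using q by (intro mult_left_mono) auto
      then show ?thesis using U(4) by (simp add: N)
    qed
    finally show ?thesis by (simp add: q_def algebra_simps)
  qed
  have "\<C> \<subseteq> {A i p | i p. i \<in> {1..n} \<and> p \<in> X}" using \<C>(1) by (fastforce simp: N)
  then show ?thesis using \<C>(2) a b by blast
qed

end
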